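(* Suppose $W\subseteq\mathbb{C}$ is a spiral-like domain of order $\sigma\ge 0$ with center $0$. If $f$ is an analytic function on $W$ such that $\limsup_{z\to\partial W}|f(z)|\le K<\infty$, and $|f(z)|\le Ce^{C|z|^{2p}}+C$ for all $z\in W$, for some $C>0$ and some $p>0$ with $p<\frac{\pi}{2\mathcal{A}_W\cos^2\sigma}$, then $|f(z)|\le K$ for all $z\in W$.
   Context: A domain is a nonempty connected open subset of $\mathbb{C}$. For $\sigma\ge 0$, a domain $W$ is spiral-like of order $\sigma$ with center $a$ if, for every $z\in W$, the spiral $\{a+(z-a)\exp(te^{-i\sigma}): t\le 0\}$ also lies within $W$. For $r>0$ let $\mathcal{A}_{r,W}=\max\{m(E): E \text{ is a subarc of } W\cap\{|z|=r\}\}$, where $m$ denotes angular Lebesgue measure on the circle $\{|z|=r\}$ (so the full circle has measure $2\pi$, and $\mathcal{A}_{r,W}=0$ if $W\cap\{|z|=r\}=\emptyset$). For $W$ spiral-like with center $0$, $\mathcal{A}_W=\lim_{r\to\infty}\mathcal{A}_{r,W}$ (this limit exists). If $\mathcal{A}_W\cos^2\sigma=0$, the quantity $\frac{\pi}{2\mathcal{A}_W\cos^2\sigma}$ is read as $+\infty$. $\partial W$ denotes the boundary of $W$ in $\mathbb{C}$ (the point at $\infty$ is not included). The condition $\limsup_{z\to\partial W}|f(z)|\le K$ means that $\limsup_{z\to\zeta,\, z\in W}|f(z)|\le K$ for every $\zeta\in\partial W$.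
   Formalization: The formal theorem adds that the complement of W is unbounded; without this the claim is false, e.g. W = ℂ, σ = 0, f = 1, K = 0, p = 1/8, or W = ℂ∖{0}, f(z) = z, K = 0. It fails for every W with bounded complement. *)

theory Defs
  imports "HOL-Complex_Analysis.Complex_Analysis"
begin

definition domain :: "complex set \<Rightarrow> bool" where
  "domain W \<longleftrightarrow> W \<noteq> {} \<and> connected W \<and> open W"

definition spiral_like :: "real \<Rightarrow> complex \<Rightarrow> complex set \<Rightarrow> bool" where
  "spiral_like \<sigma> a W \<longleftrightarrow>
     (\<forall>z\<in>W. {a + (z - a) * exp (of_real t * exp (- (\<i> * of_real \<sigma>))) | t::real. t \<le> 0} \<subseteq> W)"

(* Angular measure of a subset E of the circle of radius r about 0; the full circle has measure
   2 * pi for every r > 0. *)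
definition angular_measure :: "real \<Rightarrow> complex set \<Rightarrow> real" where
  "angular_measure r E = measure lebesgue {\<theta>. 0 \<le> \<theta> \<and> \<theta> < 2 * pi \<and> of_real r * cis \<theta> \<in> E}"

(* The subarcs of a set are its connected subsets on the circle. The empty set is one of them, so the
   supremum is 0 if W does not meet the circle. For open W it is a maximum: it is attained at a
   connected component of the part of W on the circle. *)
definition max_arc :: "real \<Rightarrow> complex set \<Rightarrow> real" where
  "max_arc r W = Sup {angular_measure r E | E. connected E \<and> E \<subseteq> W \<inter> sphere 0 r}"

(* For W spiral-like with center 0 the limit exists: z \<mapsto> z * exp (t * exp (-i * \<sigma>)) with t \<le> 0 maps
   the part of W on one circle, by a rotation and a scaling, into the part of W on another,
   so max_arc r W is monotone in r > 0 if cos \<sigma> is nonzero; if cos \<sigma> = 0, W is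
   rotation-invariant and max_arc r W is eventually constant. *)
definition arc_limit :: "complex set \<Rightarrow> real" where
  "arc_limit W = Lim at_top (\<lambda>r. max_arc r W)"

definition critical_exponent :: "real \<Rightarrow> complex set \<Rightarrow> ereal" where
  "critical_exponent \<sigma> W =
     (if arc_limit W * (cos \<sigma>)\<^sup>2 = 0 then \<infinity> else ereal (pi / (2 * arc_limit W * (cos \<sigma>)\<^sup>2)))"

definition boundary_limsup_le :: "complex set \<Rightarrow> (complex \<Rightarrow> complex) \<Rightarrow> real \<Rightarrow> bool" where
  "boundary_limsup_le W f K \<longleftrightarrow>
     (\<forall>\<zeta>\<in>frontier W. Limsup (at \<zeta> within W) (\<lambda>z. ereal (norm (f z))) \<le> ereal K)"

end

theory Submission
  imports Defs "HOL-Real_Asymp.Real_Asymp"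
begin

text \<open>
  Suppose that \<open>cos \<sigma> \<noteq> 0\<close> and write \<open>z = exp \<zeta>\<close> with \<open>\<zeta> = x (1 - \<i> tan \<sigma>) + \<i> \<theta>\<close>, so that
  \<open>x = Re \<zeta> = ln \<bar>z\<bar>\<close>, the spirals are the lines of constant \<open>\<theta>\<close>, and rotations are translations of \<open>\<theta>\<close>.
  Sliding a path along the spirals onto a single circle shows that a connected open set of such \<open>\<zeta>\<close>
  with \<open>exp \<zeta> \<in> W\<close> and \<open>\<bar>z\<bar>\<close> large has \<open>\<theta>\<close>-width at most \<open>A\<close>, for any fixed \<open>A\<close> greater than the limit
  of the maximal arcs. The factor \<open>exp (- \<epsilon> exp (q cos \<sigma> e^(\<i> \<sigma>) \<zeta> - \<i> const))\<close> with
  \<open>2 p < q < \<pi> / (A cos\<^sup>2 \<sigma>)\<close> then beats the growth of \<open>f\<close>, and the maximum principle bounds \<open>\<bar>f\<bar>\<close> outside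
  a disc by the larger of \<open>K\<close> and its supremum inside the disc. If that supremum exceeds \<open>K\<close>, it is attained in
  \<open>W\<close> because of the boundary condition, so \<open>f\<close> is constant; this contradicts the boundary condition.
  If \<open>cos \<sigma> = 0\<close>, the domain is invariant under rotations and omits arbitrarily large circles, so it is bounded.
\<close>

section \<open>Superlevel sets and the maximum principle\<close>

text \<open>A limit point outside \<open>W\<close> would lie on the frontier, near which the limsup
  condition keeps |f| below \<open>c\<close>. The boundary condition enters the main proof only
  through this closedness.\<close>

lemma superlevel_set_closed:
  assumes W: "open W" and f: "continuous_on W f" and lim: "boundary_limsup_le W f K" and "K < c"
  shows "closed {z\<in>W. c \<le> norm (f z)}" (is "closed ?T")
proof -
  have "\<xi> \<in> ?T" if \<xi>: "\<xi> \<in> closure ?T" for \<xi>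
  proof (cases "\<xi> \<in> W")
    case True
    have "closedin (top_of_set W) (W \<inter> (\<lambda>z. norm (f z)) -` {c..})"
      by (intro continuous_closedin_preimage continuous_on_norm f closed_atLeast)
    moreover have "W \<inter> (\<lambda>z. norm (f z)) -` {c..} = ?T" by auto
    ultimately obtain S where S: "closed S" "?T = W \<inter> S"
      by (auto simp: closedin_closed)
    have "\<xi> \<in> S"
      using closure_minimal[of ?T S] S \<xi> by blast
    then show ?thesis using True S by blast
  next
    case False
    have "closure ?T \<subseteq> closure W" by (rule closure_mono) auto
    then have "\<xi> \<in> frontier W"
      using \<xi> False W by (auto simp: frontier_def interior_open)
    then have "Limsup (at \<xi> within W) (\<lambda>z. ereal (norm (f z))) < ereal c"
      using lim \<open>K < c\<close> unfolding boundary_limsup_le_def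
      by (meson ereal_less_eq(3) le_less_trans less_ereal.simps(1))
    then have "eventually (\<lambda>z. ereal (norm (f z)) < ereal c) (at \<xi> within W)"
      by (rule Limsup_lessD)
    then obtain S where S: "open S" "\<xi> \<in> S" "\<And>z. z \<in> S \<Longrightarrow> z \<noteq> \<xi> \<Longrightarrow> z \<in> W \<Longrightarrow> norm (f z) < c"
      by (auto simp: eventually_at_topological)
    then obtain z where "z \<in> S" "z \<in> ?T"
      using \<xi> by (metis (no_types, lifting) Int_emptyI open_Int_closure_eq_empty disjoint_iff)
    then show ?thesis using S(3)[of z] False by force
  qed
  then show ?thesis
    by (meson closure_subset closure_subset_eq subsetI)
qed

text \<open>Compactness of the superlevel set stands in for boundedness of \<open>D\<close> and for
  boundary values. Its frontier points lie in \<open>D\<close>, and |G| > c is impossible there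
  because the strict inequality persists on a neighbourhood.\<close>

lemma maximum_modulus_superlevel:
  fixes G :: "complex \<Rightarrow> complex"
  assumes D: "open D" and G: "G holomorphic_on D"
    and T: "compact {z\<in>D. c \<le> norm (G z)}" and "z \<in> D"
  shows "norm (G z) \<le> c"
proof (cases "c \<le> norm (G z)")
  case True
  define T' where "T' = {z\<in>D. c \<le> norm (G z)}"
  have T': "compact T'" "T' \<subseteq> D" using T by (auto simp: T'_def)
  show ?thesis
  proof (rule maximum_modulus_frontier[of G T'])
    show "G holomorphic_on interior T'"
      using G T' interior_subset by (blast intro: holomorphic_on_subset)
    show "continuous_on (closure T') G"
      using G T' by (metis compact_imp_closed closure_closed holomorphic_on_imp_continuous_on
          continuous_on_subset)
    show "bounded T'" using T' by (simp add: compact_imp_bounded)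
    show "z \<in> T'" using \<open>z \<in> D\<close> True by (simp add: T'_def)
    show "norm (G \<xi>) \<le> c" if "\<xi> \<in> frontier T'" for \<xi>
    proof (rule ccontr)
      assume *: "\<not> norm (G \<xi>) \<le> c"
      have "open (D \<inter> (\<lambda>z. norm (G z)) -` {c<..})"
        by (intro continuous_open_preimage continuous_on_norm holomorphic_on_imp_continuous_on G D
            open_greaterThan)
      moreover have "\<xi> \<in> D" using that T' by (auto simp: frontier_def compact_imp_closed)
      ultimately have "\<xi> \<in> interior T'"
        using * by (intro interiorI[of "D \<inter> (\<lambda>z. norm (G z)) -` {c<..}"]) (auto simp: T'_def)
      then show False using that by (simp add: frontier_def)
    qed
  qed
qed simp

section \<open>Angular measure and maximal arcs\<close>

text \<open>Only an inequality is claimed, so a non-measurable arc set (of measure \<open>0\<close> by convention) is harmless.\<close>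

lemma angular_measure_mult_le:
  assumes "u \<noteq> 0"
  shows "angular_measure r E \<le> angular_measure (r * norm u) ((*) u ` E)"
proof -
  define c where "c = Arg2pi u"
  have c: "0 \<le> c" "c < 2 * pi" and u: "u = of_real (norm u) * cis c"
    using Arg2pi[of u] Arg2pi_eq[of u] by (auto simp: c_def cis_conv_exp mult.commute)
  define S where "S = {\<theta>. 0 \<le> \<theta> \<and> \<theta> < 2 * pi \<and> of_real r * cis \<theta> \<in> E}"
  define S' where "S' = {\<theta>. 0 \<le> \<theta> \<and> \<theta> < 2 * pi \<and> of_real (r * norm u) * cis \<theta> \<in> (*) u ` E}"
  have iff: "of_real (r * norm u) * cis \<theta> \<in> (*) u ` E \<longleftrightarrow> of_real r * cis (\<theta> - c) \<in> E" for \<theta>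
  proof -
    have "of_real (r * norm u) * cis \<theta> = u * (of_real r * cis (\<theta> - c))"
    proof -
      have "u * (of_real r * cis (\<theta> - c)) = of_real (norm u) * of_real r * (cis c * cis (\<theta> - c))"
        by (subst u) (simp only: ac_simps)
      also have "cis c * cis (\<theta> - c) = cis \<theta>" by (simp add: cis_mult)
      finally show ?thesis by (simp only: of_real_mult ac_simps)
    qed
    then show ?thesis using assms inj_image_mem_iff[of "(*) u" "of_real r * cis (\<theta> - c)" E]
      by (simp only: inj_on_mult mult_cancel_left inj_def simp_thms)
  qed
  have S'_eq: "S' = {\<theta>. 0 \<le> \<theta> \<and> \<theta> < 2 * pi \<and> of_real r * cis (\<theta> - c) \<in> E}"
    by (simp only: S'_def iff)
  have "measure lebesgue S \<le> measure lebesgue S'"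
  proof (cases "S \<in> sets lebesgue")
    case False
    then show ?thesis by (simp add: measure_notin_sets)
  next
    case True
    \<comment> \<open>Rotation by \<open>c\<close> keeps \<open>S1\<close> below 2 pi, whereas
      \<open>S2\<close> overshoots and is shifted back by a full turn.\<close>
    define S1 where "S1 = S \<inter> {..<2 * pi - c}"
    define S2 where "S2 = S \<inter> {2 * pi - c..}"
    have "bounded S"
      by (rule bounded_subset[of "{0..2*pi}"]) (auto simp: S_def)
    have S12: "S1 \<in> lmeasurable" "S2 \<in> lmeasurable"
      using True \<open>bounded S\<close> unfolding S1_def S2_def
      by (auto intro!: bounded_set_imp_lmeasurable sets.Int)
    have per: "cis (\<theta> - 2 * pi) = cis \<theta>" for \<theta>
      by (simp flip: cis_divide)
    have eq: "S' = (+) c ` S1 \<union> (+) (c - 2 * pi) ` S2"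
    proof (intro equalityI subsetI)
      fix \<theta> assume "\<theta> \<in> S'"
      then have \<theta>: "0 \<le> \<theta>" "\<theta> < 2 * pi" "of_real r * cis (\<theta> - c) \<in> E"
        by (auto simp: S'_eq)
      show "\<theta> \<in> (+) c ` S1 \<union> (+) (c - 2 * pi) ` S2"
      proof (cases "c \<le> \<theta>")
        case True
        then have "\<theta> - c \<in> S1" using \<theta> c by (auto simp: S1_def S_def)
        then show ?thesis by (auto intro: image_eqI[of _ _ "\<theta> - c"])
      next
        case False
        have "cis (\<theta> - c + 2 * pi) = cis (\<theta> - c)"
          using per[of "\<theta> - c + 2 * pi"] by simp
        then have "\<theta> - c + 2 * pi \<in> S2" using \<theta> c False by (auto simp: S2_def S_def)
        then show ?thesis by (auto intro: image_eqI[of _ _ "\<theta> - c + 2 * pi"])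
      qed
    next
      fix \<theta> assume "\<theta> \<in> (+) c ` S1 \<union> (+) (c - 2 * pi) ` S2"
      then show "\<theta> \<in> S'"
        using c per by (auto simp: S'_eq S1_def S2_def S_def)
    qed
    have disj: "(+) c ` S1 \<inter> (+) (c - 2 * pi) ` S2 = {}"
      by (auto simp: S1_def S2_def S_def)
    have "measure lebesgue S = measure lebesgue S1 + measure lebesgue S2"
    proof -
      have "S1 \<union> S2 = S" "S1 \<inter> S2 = {}" by (auto simp: S1_def S2_def)
      then show ?thesis using measure_Un3[OF S12] by simp
    qed
    also have "\<dots> = measure lebesgue S'"
      unfolding eq using measure_Un3[OF S12[THEN measurable_translation], of c "c - 2 * pi"] disj
      by (simp only: measure_translation measure_empty diff_zero)
    finally show ?thesis by simp
  qed
  then show ?thesis by (simp add: angular_measure_def S_def S'_def)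
qed

lemma angular_measure_bounds: "0 \<le> angular_measure r E" "angular_measure r E \<le> 2 * pi"
proof -
  show "0 \<le> angular_measure r E" by (simp add: angular_measure_def)
  let ?S = "{\<theta>. 0 \<le> \<theta> \<and> \<theta> < 2 * pi \<and> of_real r * cis \<theta> \<in> E}"
  have "measure lebesgue ?S \<le> measure lebesgue {0..2*pi}" if "?S \<in> sets lebesgue"
    by (rule measure_mono_fmeasurable) (use that in auto)
  then show "angular_measure r E \<le> 2 * pi"
    by (cases "?S \<in> sets lebesgue") (auto simp: angular_measure_def measure_notin_sets)
qed

lemma bdd_above_angular_measures:
  "bdd_above {angular_measure r E | E. connected E \<and> E \<subseteq> W \<inter> sphere 0 r}"
  by (rule bdd_aboveI[of _ "2 * pi"]) (auto intro: angular_measure_bounds)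

lemma angular_measure_le_max_arc:
  assumes "connected E" "E \<subseteq> W \<inter> sphere 0 r"
  shows "angular_measure r E \<le> max_arc r W"
  unfolding max_arc_def using assms by (intro cSup_upper bdd_above_angular_measures) auto

lemma max_arc_leI:
  assumes "\<And>E. connected E \<Longrightarrow> E \<subseteq> W \<inter> sphere 0 r \<Longrightarrow> angular_measure r E \<le> A"
  shows "max_arc r W \<le> A"
  unfolding max_arc_def using assms by (intro cSup_least) (auto intro: exI[of _ "{}"])

lemma max_arc_bounds: "0 \<le> max_arc r W" "max_arc r W \<le> 2 * pi"
proof -
  show "0 \<le> max_arc r W"
    using angular_measure_le_max_arc[of "{}" W r] angular_measure_bounds(1)[of r "{}"] by simp
  show "max_arc r W \<le> 2 * pi"
    by (rule max_arc_leI) (rule angular_measure_bounds)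
qed

section \<open>Sliding along spirals and the limit of the maximal arcs\<close>

text \<open>This allows the spiral parameter to be rescaled to x = t cos \<sigma>, the change of ln
  |z|.\<close>

lemma spiral_direction:
  assumes "cos \<sigma> \<noteq> 0"
  shows "exp (- (\<i> * of_real \<sigma>)) = of_real (cos \<sigma>) * Complex 1 (- tan \<sigma>)"
  using assms by (auto simp: complex_eq_iff tan_def Re_exp Im_exp)

text \<open>The sign condition says that the slide goes inwards if \<open>cos \<sigma> > 0\<close> and outwards if \<open>cos \<sigma> < 0\<close>.\<close>

lemma spiral_like_slide:
  assumes "spiral_like \<sigma> 0 W" "cos \<sigma> \<noteq> 0" "x * cos \<sigma> \<le> 0" "z \<in> W"
  shows "z * exp (of_real x * Complex 1 (- tan \<sigma>)) \<in> W"
proof -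
  have "x / cos \<sigma> \<le> 0"
    using assms(2,3) by (auto simp: mult_le_0_iff divide_le_0_iff)
  then have "0 + (z - 0) * exp (of_real (x / cos \<sigma>) * exp (- (\<i> * of_real \<sigma>))) \<in> W"
    using assms(1,4) unfolding spiral_like_def by blast
  moreover have "of_real (x / cos \<sigma>) * exp (- (\<i> * of_real \<sigma>)) = of_real x * Complex 1 (- tan \<sigma>)"
    using assms(2) by (subst spiral_direction) auto
  ultimately show ?thesis by simp
qed

text \<open>One factor \<open>u\<close> of modulus s / r slides all points of the circle at once, so
  arcs are rotated rigidly.\<close>

lemma max_arc_le_max_arc:
  assumes "spiral_like \<sigma> 0 W" "cos \<sigma> \<noteq> 0" "0 < r" "0 < s" "(s - r) * cos \<sigma> \<le> 0"
  shows "max_arc r W \<le> max_arc s W"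
proof (rule max_arc_leI)
  fix E assume E: "connected E" "E \<subseteq> W \<inter> sphere 0 r"
  define x where "x = ln (s / r)"
  define u where "u = exp (of_real x * Complex 1 (- tan \<sigma>))"
  have "x * cos \<sigma> \<le> 0"
    using assms(2-5) by (auto simp: x_def mult_le_0_iff)
  have norm_u: "norm u = s / r"
    using assms(3,4) by (simp add: u_def x_def)
  have "angular_measure r E \<le> angular_measure (r * norm u) ((*) u ` E)"
    by (rule angular_measure_mult_le) (simp add: u_def)
  also have "r * norm u = s" using assms(3) norm_u by simp
  also have "angular_measure s ((*) u ` E) \<le> max_arc s W"
  proof (rule angular_measure_le_max_arc)
    show "connected ((*) u ` E)"
      by (intro connected_continuous_image continuous_intros E)
    show "(*) u ` E \<subseteq> W \<inter> sphere 0 s"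
    proof
      fix y assume "y \<in> (*) u ` E"
      then obtain z where z: "z \<in> E" "y = z * u" by auto
      have "y \<in> W"
        using spiral_like_slide[OF assms(1,2) \<open>x * cos \<sigma> \<le> 0\<close>, of z] z E by (auto simp: u_def)
      then show "y \<in> W \<inter> sphere 0 s"
        using z E norm_u assms(3) by (auto simp: norm_mult)
    qed
  qed
  finally show "angular_measure r E \<le> max_arc s W" .
qed

text \<open>The maximal arcs are bounded and monotone in r > 0: decreasing if cos \<sigma> > 0,
  increasing if cos \<sigma> < 0.\<close>

lemma max_arc_tendsto:
  assumes "spiral_like \<sigma> 0 W" "cos \<sigma> \<noteq> 0"
  shows "((\<lambda>r. max_arc r W) \<longlongrightarrow> arc_limit W) at_top"
proof -
  have mono: "max_arc r W \<le> max_arc s W" if "0 < r" "0 < s" "(s - r) * cos \<sigma> \<le> 0" for r s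
    using max_arc_le_max_arc[OF assms] that by blast
  let ?V = "(\<lambda>r. max_arc r W) ` {0<..}"
  have bdd: "bdd_above ?V" "bdd_below ?V"
    by (auto intro!: bdd_aboveI[of _ "2 * pi"] bdd_belowI[of _ 0] max_arc_bounds)
  have "\<exists>L. ((\<lambda>r. max_arc r W) \<longlongrightarrow> L) at_top"
  proof (cases "cos \<sigma> > 0")
    case True
    have "((\<lambda>r. max_arc r W) \<longlongrightarrow> Inf ?V) at_top"
    proof (rule decreasing_tendsto)
      show "\<forall>\<^sub>F r in at_top. Inf ?V \<le> max_arc r W"
        using eventually_gt_at_top[of 0] by eventually_elim (auto intro: cInf_lower bdd)
      fix y assume "Inf ?V < y"
      then obtain s where s: "s > 0" "max_arc s W < y"
        by (subst (asm) cInf_less_iff) (auto intro: bdd exI[of _ 1])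
      show "\<forall>\<^sub>F r in at_top. max_arc r W < y"
        using eventually_ge_at_top[of s]
      proof eventually_elim
        case (elim r)
        then show ?case using mono[of r s] s True by (auto simp: mult_le_0_iff)
      qed
    qed
    then show ?thesis by blast
  next
    case False
    have "((\<lambda>r. max_arc r W) \<longlongrightarrow> Sup ?V) at_top"
    proof (rule increasing_tendsto)
      show "\<forall>\<^sub>F r in at_top. max_arc r W \<le> Sup ?V"
        using eventually_gt_at_top[of 0] by eventually_elim (auto intro: cSup_upper bdd)
      fix y assume "y < Sup ?V"
      then obtain s where s: "s > 0" "y < max_arc s W"
        by (subst (asm) less_cSup_iff) (auto intro: bdd exI[of _ 1])
      show "\<forall>\<^sub>F r in at_top. y < max_arc r W"
        using eventually_ge_at_top[of s]
      proof eventually_elim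
        case (elim r)
        then show ?case using mono[of s r] s False by (auto simp: mult_le_0_iff)
      qed
    qed
    then show ?thesis by blast
  qed
  then show ?thesis
    unfolding arc_limit_def using tendsto_Lim[OF trivial_limit_at_top_linorder] by metis
qed

section \<open>Angular width of the logarithmic lift\<close>

lemma angular_measure_initial_arc:
  assumes "r > 0" "0 \<le> l" "l < 2 * pi"
  shows "angular_measure r ((\<lambda>\<theta>. of_real r * cis \<theta>) ` {0..l}) = l"
proof -
  have "\<theta> = \<phi>" if "cis \<theta> = cis \<phi>" "0 \<le> \<theta>" "\<theta> < 2 * pi" "0 \<le> \<phi>" "\<phi> < 2 * pi" for \<theta> \<phi>
    using that Arg2pi_unique[of 1 \<theta> "cis \<theta>"] Arg2pi_unique[of 1 \<phi> "cis \<phi>"]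
    by (simp add: cis_conv_exp mult.commute)
  then have "{\<theta>. 0 \<le> \<theta> \<and> \<theta> < 2 * pi \<and>
      of_real r * cis \<theta> \<in> (\<lambda>\<theta>. of_real r * cis \<theta>) ` {0..l}} = {0..l}"
    using assms by fastforce
  then show ?thesis using assms by (simp add: angular_measure_def)
qed

text \<open>Angular measure is capped at 2 pi, so wrapping around must be excluded; the omitted
  point of the circle does this. The arc is then rotated to start at angle 0, where it does not
  cross the cut used by \<open>angular_measure\<close>.\<close>

lemma interval_le_max_arc:
  assumes "r > 0" and arc: "\<And>\<theta>. a \<le> \<theta> \<Longrightarrow> \<theta> \<le> b \<Longrightarrow> of_real r * cis \<theta> \<in> W"
    and "a \<le> b" and "\<not> sphere 0 r \<subseteq> W"
  shows "b - a \<le> max_arc r W"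
proof -
  let ?e = "\<lambda>\<theta>. of_real r * cis \<theta>"
  have "b - a < 2 * pi"
  proof (rule ccontr)
    assume *: "\<not> b - a < 2 * pi"
    obtain z where z: "norm z = r" "z \<notin> W"
      using assms(4) by (metis mem_sphere_0 subsetI)
    \<comment> \<open>The omitted point has an argument a + t with 0 \<le> t < 2 pi, which would lie
      in the interval.\<close>
    define t where "t = Arg2pi (z * cis (- a))"
    have t: "0 \<le> t" "t < 2 * pi" "z * cis (- a) = of_real (norm (z * cis (- a))) * cis t"
      using Arg2pi[of "z * cis (- a)"] Arg2pi_eq[of "z * cis (- a)"]
      by (auto simp: t_def cis_conv_exp mult.commute)
    have "z = z * cis (- a) * cis a" by (simp add: cis_mult mult.assoc)
    also have "\<dots> = ?e (a + t)"
      by (subst t(3)) (simp add: norm_mult z cis_mult mult.assoc add.commute)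
    finally have "z = ?e (a + t)" .
    then show False using * arc[of "a + t"] t z by simp
  qed
  then have "b - a = angular_measure r (?e ` {0..b - a})"
    using angular_measure_initial_arc[of r "b - a"] assms by simp
  also have "\<dots> \<le> angular_measure (r * norm (cis a)) ((*) (cis a) ` ?e ` {0..b - a})"
    by (rule angular_measure_mult_le) simp
  also have "r * norm (cis a) = r" by simp
  also have "angular_measure r ((*) (cis a) ` ?e ` {0..b - a}) \<le> max_arc r W"
  proof (rule angular_measure_le_max_arc)
    show "connected ((*) (cis a) ` ?e ` {0..b - a})"
      by (intro connected_continuous_image continuous_intros) auto
    have "cis a * ?e t = ?e (a + t)" for t by (metis cis_mult mult.left_commute)
    moreover have "?e (a + t) \<in> W" if "t \<in> {0..b - a}" for t using arc that by auto
    ultimately have "cis a * ?e t \<in> W \<inter> sphere 0 r" if "t \<in> {0..b - a}" for t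
      using that \<open>r > 0\<close>
      by (metis IntI abs_of_pos mem_sphere_0 mult.right_neutral norm_cis norm_mult norm_of_real)
    then show "(*) (cis a) ` ?e ` {0..b - a} \<subseteq> W \<inter> sphere 0 r"
      by blast
  qed
  finally show ?thesis .
qed

text \<open>Compactness of a path joining the two points gives a circle onto which all of the path
  can be slid in the permitted direction. There the path sweeps out every angle between those of its
  ends.\<close>

lemma lifted_width:
  assumes W: "spiral_like \<sigma> 0 W" and cos: "cos \<sigma> \<noteq> 0"
    and D: "open D" "connected D" "exp ` D \<subseteq> W"
    and arc: "\<And>\<zeta>. \<zeta> \<in> D \<Longrightarrow> max_arc (exp (Re \<zeta>)) W \<le> A \<and> \<not> sphere 0 (exp (Re \<zeta>)) \<subseteq> W"
    and "\<zeta>1 \<in> D" "\<zeta>2 \<in> D"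
  shows "(Im \<zeta>2 + tan \<sigma> * Re \<zeta>2) - (Im \<zeta>1 + tan \<sigma> * Re \<zeta>1) \<le> A"
proof -
  define \<theta> where "\<theta> \<zeta> = Im \<zeta> + tan \<sigma> * Re \<zeta>" for \<zeta>
  have "path_connected D" using D by (simp add: connected_open_path_connected)
  then obtain g where g: "path g" "path_image g \<subseteq> D" "pathstart g = \<zeta>1" "pathfinish g = \<zeta>2"
    using \<open>\<zeta>1 \<in> D\<close> \<open>\<zeta>2 \<in> D\<close> unfolding path_connected_def by blast
  define P where "P = path_image g"
  have P: "compact P" "connected P" "P \<subseteq> D" "\<zeta>1 \<in> P" "\<zeta>2 \<in> P"
    using g by (auto simp: P_def compact_path_image connected_path_image)
  have "\<exists>\<zeta>\<in>P. \<forall>\<eta>\<in>P. Re \<zeta> * cos \<sigma> \<le> Re \<eta> * cos \<sigma>"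
    using P by (intro continuous_attains_inf continuous_intros) auto
  then obtain \<zeta>0 where \<zeta>0: "\<zeta>0 \<in> P" "\<And>\<eta>. \<eta> \<in> P \<Longrightarrow> Re \<zeta>0 * cos \<sigma> \<le> Re \<eta> * cos \<sigma>"
    by metis
  define x where "x = Re \<zeta>0"
  \<comment> \<open>By the choice of \<open>\<zeta>0\<close>, every point of \<open>P\<close> can be slid onto the circle of radius \<open>exp x\<close>.\<close>
  show ?thesis
  proof (cases "\<theta> \<zeta>1 \<le> \<theta> \<zeta>2")
    case True
    have "(\<theta> \<zeta>2 - x * tan \<sigma>) - (\<theta> \<zeta>1 - x * tan \<sigma>) \<le> max_arc (exp x) W"
    proof (rule interval_le_max_arc)
      fix t assume t: "\<theta> \<zeta>1 - x * tan \<sigma> \<le> t" "t \<le> \<theta> \<zeta>2 - x * tan \<sigma>"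
      \<comment> \<open>The coordinate \<theta> is constant along slides, so the intermediate value
        property supplies a point of the path for each angle \<open>t\<close>.\<close>
      have "connected (\<theta> ` P)"
        unfolding \<theta>_def by (intro connected_continuous_image continuous_intros P)
      then have "t + x * tan \<sigma> \<in> \<theta> ` P"
        by (rule connectedD_interval[of _ "\<theta> \<zeta>1" "\<theta> \<zeta>2"]) (use P t in simp_all)
      then obtain \<zeta> where \<zeta>: "\<zeta> \<in> P" "t + x * tan \<sigma> = \<theta> \<zeta>" by auto
      have "exp \<zeta> * exp (of_real (x - Re \<zeta>) * Complex 1 (- tan \<sigma>)) \<in> W"
        using \<zeta>0(2)[OF \<zeta>(1)] \<zeta> P D
        by (intro spiral_like_slide[OF W cos]) (auto simp: x_def algebra_simps)
      also have "exp \<zeta> * exp (of_real (x - Re \<zeta>) * Complex 1 (- tan \<sigma>)) = exp (Complex x t)"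
        unfolding exp_add[symmetric] using \<zeta>(2)
        by (intro arg_cong[where f = exp]) (simp add: complex_eq_iff \<theta>_def algebra_simps)
      also have "\<dots> = of_real (exp x) * cis t"
        by (simp add: exp_eq_polar exp_of_real)
      finally show "of_real (exp x) * cis t \<in> W" .
    qed (use True \<zeta>0 P arc x_def in auto)
    then show ?thesis using arc[of \<zeta>0] \<zeta>0(1) P by (auto simp: x_def \<theta>_def)
  next
    case False
    then show ?thesis
      using max_arc_bounds(1)[of "exp (Re \<zeta>1)" W] arc[OF \<open>\<zeta>1 \<in> D\<close>] by (simp add: \<theta>_def)
  qed
qed

section \<open>Decay of the damping factor; circles that meet the complement\<close>

lemma double_exponential_decay:
  fixes a b c d C :: real
  assumes "0 < a" "a < b" "0 < d" "0 < C" "0 < c"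
  obtains X where "\<And>x. X \<le> x \<Longrightarrow> (C * exp (C * exp (a * x)) + C) * exp (- (d * exp (b * x))) < c"
proof -
  have "((\<lambda>x. (C * exp (C * exp (a * x)) + C) * exp (- (d * exp (b * x)))) \<longlongrightarrow> 0) at_top"
    using assms by real_asymp
  then have "\<forall>\<^sub>F x in at_top. (C * exp (C * exp (a * x)) + C) * exp (- (d * exp (b * x))) < c"
    using \<open>0 < c\<close> by (rule order_tendstoD)
  then show ?thesis using that by (auto simp: eventually_at_top_linorder)
qed

text \<open>A full circle in \<open>W\<close> would slide onto the whole circle through
  \<open>w\<close>. The sign condition puts \<open>w\<close> on the side towards which slides
  go.\<close>

lemma sphere_not_subset:
  assumes W: "spiral_like \<sigma> 0 W" "cos \<sigma> \<noteq> 0"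
    and "w \<notin> W" "w \<noteq> 0" "0 < r" "(norm w - r) * cos \<sigma> \<le> 0"
  shows "\<not> sphere 0 r \<subseteq> W"
proof
  assume sub: "sphere 0 r \<subseteq> W"
  define x where "x = ln (norm w / r)"
  define u where "u = exp (of_real x * Complex 1 (- tan \<sigma>))"
  have u: "norm u = norm w / r" "u \<noteq> 0"
    using assms by (simp_all add: u_def x_def)
  have "x * cos \<sigma> \<le> 0"
    using assms by (auto simp: x_def mult_le_0_iff)
  moreover have "w / u \<in> W"
    using u assms sub by (intro subsetD[OF sub]) (simp add: norm_divide)
  ultimately have "w / u * u \<in> W"
    unfolding u_def by (intro spiral_like_slide[OF W])
  then show False using u \<open>w \<notin> W\<close> by simp
qed

text \<open>If cos \<sigma> > 0, one omitted nonzero point excludes all larger circles. If cos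
  \<sigma> < 0, slides go outwards and an omitted point beyond each circle is used.\<close>

lemma eventually_sphere_not_subset:
  assumes W: "spiral_like \<sigma> 0 W" "cos \<sigma> \<noteq> 0" and unb: "\<not> bounded (- W)"
  shows "\<forall>\<^sub>F r in at_top. \<not> sphere 0 r \<subseteq> W"
proof -
  have far: "\<exists>w. w \<notin> W \<and> r < norm w" for r
    using unb by (auto simp: bounded_iff not_le)
  show ?thesis
  proof (cases "cos \<sigma> > 0")
    case True
    obtain w where w: "w \<notin> W" "0 < norm w" using far[of 0] by auto
    show ?thesis
      using eventually_ge_at_top[of "norm w"]
    proof eventually_elim
      case (elim r)
      then have "0 < r" using w by linarith
      moreover have "(norm w - r) * cos \<sigma> \<le> 0"
        using elim True by (simp add: mult_le_0_iff)
      ultimately show ?case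
        using sphere_not_subset[OF W w(1)] w(2) by simp
    qed
  next
    case False
    show ?thesis
      using eventually_gt_at_top[of 0]
    proof eventually_elim
      case (elim r)
      obtain w where w: "w \<notin> W" "r < norm w" using far by auto
      then show ?case
        using elim False by (intro sphere_not_subset[OF W, of w]) (auto simp: mult_le_0_iff)
    qed
  qed
qed

text \<open>Here the direction exp (-i \<sigma>) is i or -i, so each spiral runs through the full
  circle of its starting point.\<close>

lemma spiral_like_rotation:
  assumes W: "spiral_like \<sigma> 0 W" and cos: "cos \<sigma> = 0" and "z \<in> W" "norm y = norm z"
  shows "y \<in> W"
proof (cases "z = 0")
  case False
  define \<phi> where "\<phi> = Arg2pi (y / z)"
  have \<phi>: "0 \<le> \<phi>" "\<phi> < 2 * pi" "y / z = of_real (norm (y / z)) * cis \<phi>"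
    using Arg2pi[of "y / z"] Arg2pi_eq[of "y / z"] by (auto simp: \<phi>_def cis_conv_exp)
  then have y: "y = z * cis \<phi>"
    using False \<open>norm y = norm z\<close> by (simp add: norm_divide field_simps)
  have sin: "sin \<sigma> = 1 \<or> sin \<sigma> = -1"
    using cos sin_cos_squared_add[of \<sigma>] by (simp add: power2_eq_1_iff)
  \<comment> \<open>Only t \<le> 0 is allowed, so depending on the sense the rotation is by \<phi>
    or by \<phi> - 2 pi.\<close>
  define t where "t = (if sin \<sigma> = 1 then - \<phi> else \<phi> - 2 * pi)"
  have "exp (- (\<i> * of_real \<sigma>)) = - (\<i> * of_real (sin \<sigma>))"
    using cos by (simp add: complex_eq_iff Re_exp Im_exp)
  then have "exp (of_real t * exp (- (\<i> * of_real \<sigma>))) = cis (- t * sin \<sigma>)"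
    by (simp add: cis_conv_exp mult_ac)
  also have "\<dots> = cis \<phi>"
  proof (cases "sin \<sigma> = 1")
    case False
    then have "cis (- t * sin \<sigma>) = cis (\<phi> - 2 * pi)"
      using sin by (simp add: t_def)
    then show ?thesis by (simp flip: cis_divide)
  qed (simp add: t_def)
  finally have "y = 0 + (z - 0) * exp (of_real t * exp (- (\<i> * of_real \<sigma>)))"
    using y by simp
  moreover have "t \<le> 0" using \<phi> by (simp add: t_def)
  ultimately show ?thesis
    using W \<open>z \<in> W\<close> unfolding spiral_like_def by blast
qed (use assms in auto)

text \<open>Together with \<open>w\<close> its whole circle is omitted, and a connected
  \<open>W\<close> with a point inside that circle cannot cross it.\<close>

lemma spiral_like_cos_0_imp_bounded:
  assumes W: "spiral_like \<sigma> 0 W" and cos: "cos \<sigma> = 0"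
    and "connected W" and unb: "\<not> bounded (- W)"
  shows "bounded W"
proof (cases "W = {}")
  case False
  then obtain z where z: "z \<in> W" by auto
  obtain w where w: "w \<notin> W" "norm z < norm w"
    using unb by (auto simp: bounded_iff not_le)
  have "norm y < norm w" if "y \<in> W" for y
  proof (rule ccontr)
    assume "\<not> norm y < norm w"
    moreover have "connected (norm ` W)"
      by (intro connected_continuous_image continuous_intros \<open>connected W\<close>)
    ultimately have "norm w \<in> norm ` W"
      using connectedD_interval[of "norm ` W" "norm z" "norm y" "norm w"] z w \<open>y \<in> W\<close> by simp
    then show False using spiral_like_rotation[OF W cos] w by force
  qed
  then show ?thesis by (intro boundedI[of _ "norm w"]) (simp add: less_imp_le)
qed simp

section \<open>A Phragmen-Lindelof estimate outside a disc\<close>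

text \<open>The midpoint of infimum and supremum serves as \<open>m\<close>. Centring the strip lets
  the argument of the damping exponent stay within (-pi / 2, pi / 2).\<close>

lemma exists_center:
  fixes \<theta> :: "'a \<Rightarrow> real"
  assumes "D \<noteq> {}" and diff: "\<And>x y. x \<in> D \<Longrightarrow> y \<in> D \<Longrightarrow> \<theta> y - \<theta> x \<le> A"
  obtains m where "\<And>x. x \<in> D \<Longrightarrow> \<bar>\<theta> x - m\<bar> \<le> A / 2"
proof
  obtain a where a: "a \<in> D" using assms by auto
  have bdd: "bdd_above (\<theta> ` D)" "bdd_below (\<theta> ` D)"
    using diff[OF a] diff[OF _ a]
    by (auto intro!: bdd_aboveI2[of _ _ "A + \<theta> a"] bdd_belowI2[of _ "\<theta> a - A"] simp: algebra_simps)
  fix x assume x: "x \<in> D"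
  have "Sup (\<theta> ` D) \<le> A + Inf (\<theta> ` D)"
  proof (rule cSUP_least)
    fix y assume "y \<in> D"
    have "\<theta> y - A \<le> Inf (\<theta> ` D)"
      using diff[OF _ \<open>y \<in> D\<close>] a by (intro cINF_greatest) (auto simp: algebra_simps)
    then show "\<theta> y \<le> A + Inf (\<theta> ` D)" by simp
  qed (use a in auto)
  moreover have "\<theta> x \<le> Sup (\<theta> ` D)" "Inf (\<theta> ` D) \<le> \<theta> x"
    using x bdd by (auto intro: cSUP_upper cINF_lower)
  ultimately show "\<bar>\<theta> x - (Sup (\<theta> ` D) + Inf (\<theta> ` D)) / 2\<bar> \<le> A / 2"
    by (simp add: abs_le_iff field_simps)
qed

text \<open>The closedness hypothesis encodes the boundary condition on the frontier of
  \<open>W\<close>, and \<open>disc\<close> takes care of the circle |z| = R.\<close>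

lemma norm_le_outside_disc:
  fixes f :: "complex \<Rightarrow> complex"
  assumes W: "open W" "spiral_like \<sigma> 0 W" "cos \<sigma> \<noteq> 0"
    and hol: "f holomorphic_on W"
    and closed: "\<And>c. B < c \<Longrightarrow> closed {z\<in>W. c \<le> norm (f z)}"
    and "0 \<le> B" "0 < R" "0 < A" "0 < C" "0 < p"
    and arc: "\<And>r. R \<le> r \<Longrightarrow> max_arc r W \<le> A \<and> \<not> sphere 0 r \<subseteq> W"
    and disc: "\<And>z. z \<in> W \<Longrightarrow> norm z \<le> R \<Longrightarrow> norm (f z) \<le> B"
    and growth: "\<And>z. z \<in> W \<Longrightarrow> norm (f z) \<le> C * exp (C * norm z powr (2 * p)) + C"
    and p: "2 * p * A * (cos \<sigma>)\<^sup>2 < pi"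
    and "z0 \<in> W"
  shows "norm (f z0) \<le> B"
proof (cases "norm z0 \<le> R")
  case False
  define \<Omega> where "\<Omega> = {\<zeta>. R < exp (Re \<zeta>)} \<inter> exp -` W"
  have "z0 \<noteq> 0" using False \<open>0 < R\<close> by auto
  define \<zeta>0 where "\<zeta>0 = Ln z0"
  have \<zeta>0: "exp \<zeta>0 = z0" using \<open>z0 \<noteq> 0\<close> by (simp add: \<zeta>0_def)
  have "open \<Omega>"
    unfolding \<Omega>_def using W(1)
    by (intro open_Int open_Collect_less continuous_open_vimage continuous_intros) auto
  have "\<zeta>0 \<in> \<Omega>"
    using False \<zeta>0 \<open>z0 \<in> W\<close> by (auto simp: \<Omega>_def simp flip: norm_exp_eq_Re)
  \<comment> \<open>A component is needed, since \<Omega> is invariant under translation by 2 pi i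
    and has unbounded width.\<close>
  define D where "D = connected_component_set \<Omega> \<zeta>0"
  have D: "open D" "connected D" "D \<subseteq> \<Omega>" "\<zeta>0 \<in> D"
    using \<open>open \<Omega>\<close> \<open>\<zeta>0 \<in> \<Omega>\<close>
    by (auto simp: D_def open_connected_component connected_component_subset)
  have expD: "exp \<zeta> \<in> W" "R < exp (Re \<zeta>)" if "\<zeta> \<in> D" for \<zeta>
    using that D by (auto simp: \<Omega>_def)
  define \<theta> where "\<theta> \<zeta> = Im \<zeta> + tan \<sigma> * Re \<zeta>" for \<zeta>
  have "\<theta> y - \<theta> x \<le> A" if "x \<in> D" "y \<in> D" for x y
    unfolding \<theta>_def using expD arc that
    by (intro lifted_width[OF W(2,3) D(1,2)]) (auto simp: less_imp_le)
  then obtain m where m: "\<And>\<zeta>. \<zeta> \<in> D \<Longrightarrow> \<bar>\<theta> \<zeta> - m\<bar> \<le> A / 2"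
    using exists_center[of D \<theta> A] \<open>\<zeta>0 \<in> D\<close> by blast
  have cos2: "0 < (cos \<sigma>)\<^sup>2" using W(3) by simp
  have "2 * p < pi / (A * (cos \<sigma>)\<^sup>2)"
    using p \<open>0 < A\<close> cos2 by (simp add: pos_less_divide_eq mult.assoc)
  \<comment> \<open>The lower bound makes the damping beat the growth of \<open>f\<close>; the upper
    bound makes \<delta> positive.\<close>
  then obtain q where "2 * p < q" and "q < pi / (A * (cos \<sigma>)\<^sup>2)"
    using dense by blast
  then have q: "2 * p < q" "0 < q" "q * (cos \<sigma>)\<^sup>2 * A < pi"
    using \<open>0 < A\<close> cos2 \<open>0 < p\<close> by (auto simp: pos_less_divide_eq mult_ac)
  define \<delta> where "\<delta> = cos (q * (cos \<sigma>)\<^sup>2 * A / 2)"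
  have "0 < q * (cos \<sigma>)\<^sup>2 * A" using q \<open>0 < A\<close> cos2 by simp
  then have "0 < \<delta>"
    unfolding \<delta>_def using q by (intro cos_gt_zero_pi) auto
  define \<Theta> where "\<Theta> = \<bar>m\<bar> + A / 2"
  \<comment> \<open>Since cos \<sigma> e^(i \<sigma>) (1 - i tan \<sigma>) = 1, this multiplication
    makes the spirals horizontal and shrinks the width from \<open>A\<close> to A cos^2 \<sigma>,
    whence the cos^2 in the critical exponent. The subtracted term centres the strip on the real
    axis.\<close>
  define h where "h \<zeta> = exp (of_real q *
      (of_real (cos \<sigma>) * Complex (cos \<sigma>) (sin \<sigma>) * \<zeta> - \<i> * of_real ((cos \<sigma>)\<^sup>2 * m)))" for \<zeta>
  have Re_h: "\<delta> * exp (- (q * \<Theta>)) * exp (q * Re \<zeta>) \<le> Re (h \<zeta>)" if "\<zeta> \<in> D" for \<zeta>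
  proof -
    have Im: "Im \<zeta> = \<theta> \<zeta> - sin \<sigma> / cos \<sigma> * Re \<zeta>" by (simp add: \<theta>_def tan_def)
    have sc: "Re \<zeta> * (cos \<sigma> * cos \<sigma>) + Re \<zeta> * (sin \<sigma> * sin \<sigma>) = Re \<zeta>"
      by (simp flip: distrib_left)
    define a where "a = q * (Re \<zeta> - sin \<sigma> * cos \<sigma> * \<theta> \<zeta>)"
    define b where "b = q * (cos \<sigma>)\<^sup>2 * (\<theta> \<zeta> - m)"
    have "of_real q * (of_real (cos \<sigma>) * Complex (cos \<sigma>) (sin \<sigma>) * \<zeta> - \<i> * of_real ((cos \<sigma>)\<^sup>2 * m)) =
        Complex a b" (is "?e = _")
    proof (rule complex_eqI)
      have "cos \<sigma> * cos \<sigma> * Re \<zeta> - cos \<sigma> * sin \<sigma> * Im \<zeta> = Re \<zeta> - sin \<sigma> * cos \<sigma> * \<theta> \<zeta>"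
        using W(3) sc by (simp add: Im algebra_simps)
      then show "Re ?e = Re (Complex a b)"
        by (simp add: a_def)
      have "cos \<sigma> * cos \<sigma> * Im \<zeta> + cos \<sigma> * sin \<sigma> * Re \<zeta> = cos \<sigma> * cos \<sigma> * \<theta> \<zeta>"
        using W(3) by (simp add: Im algebra_simps)
      then show "Im ?e = Im (Complex a b)"
        by (simp add: b_def power2_eq_square algebra_simps flip: distrib_left)
    qed
    then have "Re (h \<zeta>) = exp a * cos b"
      by (simp add: h_def Re_exp)
    moreover have "\<delta> \<le> cos b"
    proof -
      have "\<bar>b\<bar> \<le> q * (cos \<sigma>)\<^sup>2 * (A / 2)"
        unfolding b_def abs_mult using m[OF that] q by (intro mult_mono) auto
      then have "cos (q * (cos \<sigma>)\<^sup>2 * A / 2) \<le> cos \<bar>b\<bar>"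
        using q by (intro cos_monotone_0_pi_le) auto
      then show ?thesis by (simp add: \<delta>_def)
    qed
    moreover have "exp (- (q * \<Theta>)) * exp (q * Re \<zeta>) \<le> exp a"
    proof -
      have "sin \<sigma> * cos \<sigma> * \<theta> \<zeta> \<le> \<bar>sin \<sigma> * cos \<sigma>\<bar> * \<bar>\<theta> \<zeta>\<bar>"
        by (metis abs_ge_self abs_mult)
      also have "\<dots> \<le> 1 * \<Theta>"
      proof (rule mult_mono)
        show "\<bar>sin \<sigma> * cos \<sigma>\<bar> \<le> 1"
          by (simp add: abs_mult mult_le_one)
        show "\<bar>\<theta> \<zeta>\<bar> \<le> \<Theta>" using m[OF that] unfolding \<Theta>_def by linarith
      qed auto
      finally have "q * (sin \<sigma> * cos \<sigma> * \<theta> \<zeta>) \<le> q * \<Theta>" using q by simp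
      then show ?thesis
        by (simp add: a_def algebra_simps flip: exp_add)
    qed
    ultimately show ?thesis
      using mult_mono[of "exp (- (q * \<Theta>)) * exp (q * Re \<zeta>)" "exp a" \<delta> "cos b"] \<open>0 < \<delta>\<close>
      by (simp add: mult_ac)
  qed
  have Re_h_nonneg: "0 \<le> Re (h \<zeta>)" if "\<zeta> \<in> D" for \<zeta>
    using Re_h[OF that] \<open>0 < \<delta>\<close> by (meson exp_ge_zero less_imp_le mult_nonneg_nonneg order_trans)
  \<comment> \<open>For fixed \<epsilon> the damped function \<open>G\<close> has compact superlevel
    sets at levels above \<open>B\<close>.\<close>
  have bound: "norm (f z0) * exp (- (\<epsilon> * Re (h \<zeta>0))) \<le> c" if "B < c" "0 < \<epsilon>" for c \<epsilon>
  proof -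
    define G where "G \<zeta> = f (exp \<zeta>) * exp (- (of_real \<epsilon> * h \<zeta>))" for \<zeta>
    have norm_G: "norm (G \<zeta>) = norm (f (exp \<zeta>)) * exp (- (\<epsilon> * Re (h \<zeta>)))" for \<zeta>
      by (simp add: G_def norm_mult)
    have "(f \<circ> exp) holomorphic_on D"
      using expD by (intro holomorphic_on_compose_gen[OF _ hol] holomorphic_intros) auto
    then have G: "G holomorphic_on D"
      unfolding G_def h_def o_def by (intro holomorphic_intros)
    define T where "T = {\<zeta>\<in>D. c \<le> norm (G \<zeta>)}"
    have norm_G_le: "norm (G \<zeta>) \<le> norm (f (exp \<zeta>))" if "\<zeta> \<in> D" for \<zeta>
      using Re_h_nonneg[OF that] \<open>0 < \<epsilon>\<close> by (simp add: norm_G mult_left_le)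
    \<comment> \<open>A limit point could escape \<open>D\<close> in three ways: to the frontier of
      \<open>W\<close> (excluded by \<open>closed\<close>), to |z| = R (excluded by
      \<open>disc\<close> and c > B), or to another component (components are relatively
      closed).\<close>
    have "\<xi> \<in> T" if \<xi>: "\<xi> \<in> closure T" for \<xi>
    proof -
      have "closed (exp -` {z\<in>W. c \<le> norm (f z)})"
        using closed[OF \<open>B < c\<close>] by (intro continuous_closed_vimage) (auto intro: continuous_intros)
      moreover have "T \<subseteq> exp -` {z\<in>W. c \<le> norm (f z)}"
        using expD norm_G_le by (force simp: T_def)
      ultimately have \<xi>W: "exp \<xi> \<in> W" "c \<le> norm (f (exp \<xi>))"
        using closure_minimal \<xi> by blast+
      then have "\<not> norm (exp \<xi>) \<le> R" using disc[of "exp \<xi>"] \<open>B < c\<close> by auto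
      then have "\<xi> \<in> \<Omega>" using \<xi>W by (simp add: \<Omega>_def)
      moreover obtain S where S: "closed S" "D = \<Omega> \<inter> S"
        using closedin_connected_component[of \<Omega> \<zeta>0] by (auto simp: D_def closedin_closed)
      moreover have "\<xi> \<in> S"
        using closure_minimal[of T S] S \<xi> by (auto simp: T_def)
      ultimately have "\<xi> \<in> D" by simp
      have "closedin (top_of_set D) (D \<inter> (\<lambda>z. norm (G z)) -` {c..})"
        by (intro continuous_closedin_preimage continuous_on_norm
            holomorphic_on_imp_continuous_on G closed_atLeast)
      moreover have "D \<inter> (\<lambda>z. norm (G z)) -` {c..} = T" by (auto simp: T_def)
      ultimately obtain S' where S': "closed S'" "T = D \<inter> S'"
        by (auto simp: closedin_closed)
      then have "\<xi> \<in> S'" using closure_minimal[of T S'] \<xi> by blast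
      then show ?thesis using S' \<open>\<xi> \<in> D\<close> by simp
    qed
    then have "closed T" by (meson closure_subset closure_subset_eq subsetI)
    \<comment> \<open>The decay bounds Re \<zeta> above, the disc bounds it below, and the angular
      width then bounds Im \<zeta>.\<close>
    have "bounded T"
    proof -
      define d where "d = \<epsilon> * (\<delta> * exp (- (q * \<Theta>)))"
      have "0 < d" using \<open>0 < \<epsilon>\<close> \<open>0 < \<delta>\<close> by (simp add: d_def)
      obtain X where X: "\<And>x. X \<le> x \<Longrightarrow>
          (C * exp (C * exp (2 * p * x)) + C) * exp (- (d * exp (q * x))) < c"
        using double_exponential_decay[of "2 * p" q d C c] \<open>0 < p\<close> q \<open>0 < d\<close> \<open>0 < C\<close> \<open>0 \<le> B\<close> \<open>B < c\<close>
        by auto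
      have "norm \<zeta> \<le> (\<bar>X\<bar> + \<bar>ln R\<bar>) + (\<Theta> + \<bar>tan \<sigma>\<bar> * (\<bar>X\<bar> + \<bar>ln R\<bar>))" if "\<zeta> \<in> T" for \<zeta>
      proof -
        have \<zeta>: "\<zeta> \<in> D" "c \<le> norm (G \<zeta>)" using that by (auto simp: T_def)
        have "norm (G \<zeta>) \<le> (C * exp (C * exp (2 * p * Re \<zeta>)) + C) * exp (- (d * exp (q * Re \<zeta>)))"
          unfolding norm_G
        proof (rule mult_mono)
          show "norm (f (exp \<zeta>)) \<le> C * exp (C * exp (2 * p * Re \<zeta>)) + C"
            using growth[OF expD(1)[OF \<zeta>(1)]] by (simp add: powr_def mult_ac)
          show "exp (- (\<epsilon> * Re (h \<zeta>))) \<le> exp (- (d * exp (q * Re \<zeta>)))"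
            using mult_left_mono[OF Re_h[OF \<zeta>(1)], of \<epsilon>] \<open>0 < \<epsilon>\<close> by (simp add: d_def mult_ac)
        qed (use \<open>0 < C\<close> in auto)
        then have "\<not> X \<le> Re \<zeta>" using X[of "Re \<zeta>"] \<zeta>(2) by auto
        moreover have "ln R < Re \<zeta>"
          using expD(2)[OF \<zeta>(1)] \<open>0 < R\<close> by (metis exp_gt_zero ln_exp ln_less_cancel_iff)
        ultimately have Re: "\<bar>Re \<zeta>\<bar> \<le> \<bar>X\<bar> + \<bar>ln R\<bar>" by linarith
        have "\<bar>\<theta> \<zeta>\<bar> \<le> \<Theta>" using m[OF \<zeta>(1)] unfolding \<Theta>_def by linarith
        moreover have "\<bar>Im \<zeta>\<bar> \<le> \<bar>\<theta> \<zeta>\<bar> + \<bar>tan \<sigma>\<bar> * \<bar>Re \<zeta>\<bar>"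
          unfolding abs_mult[symmetric] by (simp add: \<theta>_def)
        moreover have "\<bar>tan \<sigma>\<bar> * \<bar>Re \<zeta>\<bar> \<le> \<bar>tan \<sigma>\<bar> * (\<bar>X\<bar> + \<bar>ln R\<bar>)"
          using Re by (intro mult_left_mono) auto
        ultimately show ?thesis using Re cmod_le[of \<zeta>] by linarith
      qed
      then show ?thesis by (auto simp: bounded_iff)
    qed
    have "norm (G \<zeta>0) \<le> c"
      using \<open>closed T\<close> \<open>bounded T\<close> D(1,4) G
      by (intro maximum_modulus_superlevel[of D]) (auto simp: T_def compact_eq_bounded_closed)
    then show ?thesis by (simp add: norm_G \<zeta>0)
  qed
  \<comment> \<open>Letting \<epsilon> tend to 0 removes the damping, after which \<open>c\<close>
    decreases to \<open>B\<close>.\<close>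
  have "norm (f z0) \<le> c" if "B < c" for c
  proof (rule tendsto_upperbound)
    show "((\<lambda>\<epsilon>. norm (f z0) * exp (- (\<epsilon> * Re (h \<zeta>0)))) \<longlongrightarrow> norm (f z0)) (at_right 0)"
      by (auto intro!: tendsto_eq_intros)
    show "\<forall>\<^sub>F \<epsilon> in at_right 0. norm (f z0) * exp (- (\<epsilon> * Re (h \<zeta>0))) \<le> c"
      using eventually_at_right_less[of 0] by eventually_elim (use bound that in auto)
  qed simp
  then show ?thesis by (rule dense_ge)
qed (use assms in auto)

section \<open>The bound on all of \<open>W\<close>\<close>

theorem corollary2:
  fixes W :: "complex set" and f :: "complex \<Rightarrow> complex" and \<sigma> K C p :: real
  assumes "domain W"
    and "\<sigma> \<ge> 0"
    and "spiral_like \<sigma> 0 W"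
    and "\<not> bounded (- W)"
    and "f analytic_on W"
    and "boundary_limsup_le W f K"
    and "C > 0" and "p > 0"
    and "ereal p < critical_exponent \<sigma> W"
    and "\<forall>z\<in>W. norm (f z) \<le> C * exp (C * norm z powr (2 * p)) + C"
  shows "\<forall>z\<in>W. norm (f z) \<le> K"
proof -
  have W: "open W" "connected W" "W \<noteq> {}"
    using assms(1) by (auto simp: domain_def)
  have hol: "f holomorphic_on W"
    using assms(5) by (rule analytic_imp_holomorphic)
  have closed: "closed {z\<in>W. c \<le> norm (f z)}" if "K < c" for c
    using superlevel_set_closed[OF W(1) holomorphic_on_imp_continuous_on[OF hol] assms(6) that] .
  \<comment> \<open>A closed \<open>W\<close> would be the whole plane, whose complement is empty
    and hence bounded.\<close>
  have "\<not> closed W"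
  proof
    assume "closed W"
    then have "W = UNIV" using W clopen[of W] by auto
    then show False using assms(4) by simp
  qed
  have not_all: "\<not> (\<forall>z\<in>W. c \<le> norm (f z))" if "K < c" for c
  proof
    assume "\<forall>z\<in>W. c \<le> norm (f z)"
    then have "{z\<in>W. c \<le> norm (f z)} = W" by auto
    then show False using closed[OF that] \<open>\<not> closed W\<close> by simp
  qed
  \<comment> \<open>If \<open>K\<close> were negative, \<open>W\<close> would be its own superlevel
    set at level 0.\<close>
  have "0 \<le> K" using not_all[of 0] by force
  \<comment> \<open>One \<open>R\<close> has to serve all \<open>B\<close>: it is used with B = K
    and later with the maximum of |f| over the disc.\<close>
  have "\<exists>R. \<forall>B\<ge>K. (\<forall>z\<in>W \<inter> cball 0 R. norm (f z) \<le> B) \<longrightarrow> (\<forall>z\<in>W. norm (f z) \<le> B)"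
  proof (cases "cos \<sigma> = 0")
    case True
    then have "bounded W"
      using spiral_like_cos_0_imp_bounded assms(3,4) W by blast
    then obtain R where "W \<subseteq> cball 0 R" by (auto simp: bounded_iff subset_iff)
    then show ?thesis by blast
  next
    case False
    define L where "L = arc_limit W"
    have lim: "((\<lambda>r. max_arc r W) \<longlongrightarrow> L) at_top"
      unfolding L_def by (rule max_arc_tendsto[OF assms(3) False])
    have "0 \<le> L"
      by (rule tendsto_lowerbound[OF lim]) (simp_all add: max_arc_bounds)
    have cos2: "0 < (cos \<sigma>)\<^sup>2" using False by simp
    \<comment> \<open>This form covers the infinite critical exponent too: then L = 0 and the left
      side vanishes.\<close>
    have "2 * p * L * (cos \<sigma>)\<^sup>2 < pi"
    proof (cases "L = 0")
      case False
      then have "p < pi / (2 * L * (cos \<sigma>)\<^sup>2)"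
        using assms(9) cos2 by (simp add: critical_exponent_def L_def)
      then show ?thesis
        using False \<open>0 \<le> L\<close> cos2 by (simp add: pos_less_divide_eq mult_ac)
    qed simp
    then have "L < pi / (2 * p * (cos \<sigma>)\<^sup>2)"
      using \<open>p > 0\<close> cos2 by (simp add: pos_less_divide_eq mult_ac)
    \<comment> \<open>Strictness puts the maximal arcs eventually below \<open>A\<close>, and gives
      A > 0 even if L = 0.\<close>
    then obtain A where A: "L < A" "A < pi / (2 * p * (cos \<sigma>)\<^sup>2)" using dense by blast
    then have pA: "2 * p * A * (cos \<sigma>)\<^sup>2 < pi"
      using \<open>p > 0\<close> cos2 by (simp add: pos_less_divide_eq mult_ac)
    have "\<forall>\<^sub>F r in at_top. max_arc r W < A \<and> \<not> sphere 0 r \<subseteq> W"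
      using order_tendstoD(2)[OF lim A(1)] eventually_sphere_not_subset[OF assms(3) False assms(4)]
      by (rule eventually_conj)
    then obtain R0 where R0: "\<And>r. R0 \<le> r \<Longrightarrow> max_arc r W < A \<and> \<not> sphere 0 r \<subseteq> W"
      by (auto simp: eventually_at_top_linorder)
    define R where "R = max 1 R0"
    have "norm (f z) \<le> B" if "K \<le> B" "\<forall>z\<in>W \<inter> cball 0 R. norm (f z) \<le> B" "z \<in> W" for B z
    proof (rule norm_le_outside_disc[OF W(1) assms(3) False hol])
      show "closed {z\<in>W. c \<le> norm (f z)}" if "B < c" for c
        using closed[of c] that \<open>K \<le> B\<close> by simp
      show "max_arc r W \<le> A \<and> \<not> sphere 0 r \<subseteq> W" if "R \<le> r" for r
        using R0[of r] that by (auto simp: R_def)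
    qed (use that assms \<open>0 \<le> K\<close> \<open>0 \<le> L\<close> A pA in \<open>auto simp: R_def\<close>)
    then show ?thesis by blast
  qed
  then obtain R where R: "\<And>B. K \<le> B \<Longrightarrow> \<forall>z\<in>W \<inter> cball 0 R. norm (f z) \<le> B \<Longrightarrow> \<forall>z\<in>W. norm (f z) \<le> B"
    by blast
  show ?thesis
  proof (rule R[OF order_refl], rule ccontr)
    assume "\<not> (\<forall>z\<in>W \<inter> cball 0 R. norm (f z) \<le> K)"
    then obtain y where y: "y \<in> W" "y \<in> cball 0 R" "K < norm (f y)" by auto
    define T where "T = {z\<in>W. norm (f y) \<le> norm (f z)} \<inter> cball 0 R"
    have "compact T"
      unfolding T_def using closed[OF y(3)] by (intro closed_Int_compact compact_cball)
    moreover have "continuous_on T (\<lambda>z. norm (f z))"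
      using hol by (intro continuous_on_norm holomorphic_on_imp_continuous_on)
        (auto simp: T_def intro: holomorphic_on_subset)
    moreover have "y \<in> T" using y by (simp add: T_def)
    ultimately obtain w where w: "w \<in> T" "\<And>z. z \<in> T \<Longrightarrow> norm (f z) \<le> norm (f w)"
      using continuous_attains_sup[of T "\<lambda>z. norm (f z)"] by blast
    have "w \<in> W" "norm (f y) \<le> norm (f w)" using w by (auto simp: T_def)
    \<comment> \<open>Points of the disc outside \<open>T\<close> have |f| < |f y|, so |f w| bounds
      |f| on the disc and, by \<open>R\<close>, on \<open>W\<close>. Being constant, f would then
      have modulus |f y| > K everywhere.\<close>
    have "norm (f z) \<le> norm (f w)" if "z \<in> W \<inter> cball 0 R" for z
      using that w(2)[of z] \<open>norm (f y) \<le> norm (f w)\<close> by (cases "z \<in> T") (auto simp: T_def)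
    then have "\<forall>z\<in>W. norm (f z) \<le> norm (f w)"
      using y(3) \<open>norm (f y) \<le> norm (f w)\<close> by (intro R) auto
    then have "f constant_on W"
      using W \<open>w \<in> W\<close> by (intro maximum_modulus_principle[OF hol, of W w]) auto
    then have "\<forall>z\<in>W. norm (f y) \<le> norm (f z)"
      using y by (auto simp: constant_on_def)
    then show False using not_all[OF y(3)] by simp
  qed
qed

end
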